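(* For every given $\boldsymbol\mu\in\mathcal P$ and every given observation $y_d\in Y_{\mathrm{obs}}$, there exists a unique pair $(y,p)\in Y\times Y$ such that $$\mathcal B_s((y,p),(z,q);\boldsymbol\mu)=\langle\mathcal F_s(\boldsymbol\mu),(z,q)\rangle\qquad\text{for all }(z,q)\in Y\times Y.$$
   Context: Let $\mathcal P\subset\mathbb R^{d}$ be a parameter set, $\Omega\subset\mathbb R^n$ ($n=1,2,3$) an open bounded regular domain, $\Omega_{\mathrm{obs}}\subseteq\Omega$ the observation domain, $\Omega_u\subset\overline\Omega$ the control domain, and $0<\alpha\le1$ fixed. $Y$ is a separable Hilbert space over $\Omega$, $U$ a Hilbert space over $\Omega_u$, $Y_{\mathrm{obs}}$ a Hilbert space of observations; $Y$ and $U$ are contained in $L^2$. Moreover $Y\subseteq Y_{\mathrm{obs}}$ and $Y\subseteq U$, with constants $c_{\mathrm{obs}},c_u>0$ (possibly depending on $\boldsymbol\mu$) such that $\|y\|_{Y_{\mathrm{obs}}}\le c_{\mathrm{obs}}\|y\|_Y$ and $\|y\|_U\le c_u\|y\|_Y$ for all $y\in Y$. For each $\boldsymbol\mu\in\mathcal P$: - $a(\cdot,\cdot;\boldsymbol\mu):Y\times Y\to\mathbb R$ is bilinear, continuous with constant $c_a(\boldsymbol\mu)$ and coercive with constant $\gamma_a(\boldsymbol\mu)>0$. - $c(\cdot,\cdot;\boldsymbol\mu):U\times Y\to\mathbb R$ is bilinear, continuous with constant $c_c(\boldsymbol\mu)$, and is the $L^2$ scalar product over $\Omega_u$ weighted by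 $\sum_{i=1}^{Q_C}c_C^i(\boldsymbol\mu)\chi_{\Omega_C^i}$ with $c_C^i(\boldsymbol\mu)>0$ and $\bigcup_i\Omega_C^i=\Omega_u$; since $Y\subseteq U$, $c(p,z;\boldsymbol\mu)$ is defined for $p,z\in Y$. - $m(\cdot,\cdot;\boldsymbol\mu):Y\times Y\to\mathbb R$ is bilinear, symmetric, positive semidefinite, continuous with constant $c_m(\boldsymbol\mu)$, and is the (possibly positively weighted, because of pull-back to $\Omega$) $L^2$ scalar product over $\Omega_{\mathrm{obs}}$; it is also defined and continuous with first argument in $Y_{\mathrm{obs}}$. If $\Omega_u=\Omega_{\mathrm{obs}}$, then $c$ and $m$ coincide. The steady optimality bilinear form on $(Y\times Y)\times(Y\times Y)$ is $$\mathcal B_s((y,p),(z,q);\boldsymbol\mu)=a(y,z;\boldsymbol\mu)-\tfrac1\alpha c(p,z;\boldsymbol\mu)+m(y,q;\boldsymbol\mu)+a(q,p;\boldsymbol\mu),$$ and the right-hand side is $\langle\mathcal F_s(\boldsymbol\mu),(z,q)\rangle=m(y_d,q;\boldsymbol\mu)+\langle G(\boldsymbol\mu),z\rangle_{Y^*,Y}$ with given $G(\boldsymbol\mu)\in Y^*$. *)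

theory Defs
  imports "HOL-Analysis.Analysis"
begin

text \<open>
  A ``regular'' bounded domain is read as a bounded Lipschitz domain: a nonempty, bounded, open,
  connected set that near each boundary point \<open>x\<close> is, in suitable orthonormal coordinates with last
  axis \<open>e\<close>, the strict epigraph of a Lipschitz function \<open>g\<close> of the remaining coordinates (the
  component \<open>y - (y \<bullet> e) *\<^sub>R e\<close> of \<open>y\<close> orthogonal to \<open>e\<close>).
\<close>

definition regular_domain :: "'a::euclidean_space set \<Rightarrow> bool" where
  "regular_domain \<Omega> \<longleftrightarrow>
     open \<Omega> \<and> bounded \<Omega> \<and> connected \<Omega> \<and> \<Omega> \<noteq> {} \<and>
     (\<forall>x\<in>frontier \<Omega>. \<exists>e r L. \<exists>g :: 'a \<Rightarrow> real.
        norm e = 1 \<and> 0 < r \<and> L-lipschitz_on UNIV g \<and>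
        (\<forall>y\<in>ball x r. y \<in> \<Omega> \<longleftrightarrow> g (y - (y \<bullet> e) *\<^sub>R e) < y \<bullet> e))"

text \<open>
  The measure defining \<open>L\<^sup>2\<close> on a control region contained in \<open>closure \<Omega>\<close>: Lebesgue measure inside
  \<open>\<Omega>\<close>, and a finite Borel measure on the boundary. The latter is the surface measure for a
  boundary control and can be taken to vanish for a distributed control.
\<close>

definition control_measure :: "'a::euclidean_space set \<Rightarrow> 'a measure \<Rightarrow> bool" where
  "control_measure \<Omega> \<sigma> \<longleftrightarrow>
     sets \<sigma> = sets borel \<and>
     (\<forall>A\<in>sets borel. A \<subseteq> \<Omega> \<longrightarrow> emeasure \<sigma> A = emeasure lborel A) \<and>
     emeasure \<sigma> (frontier \<Omega>) < \<infinity>"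

text \<open>
  \<open>contained_in_L2 M A r\<close>: the vector space \<open>'h\<close> is a linear subspace of \<open>L\<^sup>2(A)\<close> with respect to \<open>M\<close>.
  The map \<open>r\<close> selects a representative function of each element; it is linear and injective
  modulo equality almost everywhere on \<open>A\<close>. No relation between the norm of \<open>'h\<close> and the
  \<open>L\<^sup>2\<close> norm is implied.
\<close>

definition contained_in_L2 ::
  "'a measure \<Rightarrow> 'a set \<Rightarrow> ('h::real_vector \<Rightarrow> 'a \<Rightarrow> real) \<Rightarrow> bool" where
  "contained_in_L2 M A r \<longleftrightarrow>
     (\<forall>v. set_borel_measurable M A (r v) \<and> set_integrable M A (\<lambda>x. (r v x)\<^sup>2)) \<and>
     (\<forall>v w. AE x\<in>A in M. r (v + w) x = r v x + r w x) \<and>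
     (\<forall>s v. AE x\<in>A in M. r (s *\<^sub>R v) x = s * r v x) \<and>
     (\<forall>v. (AE x\<in>A in M. r v x = 0) \<longrightarrow> v = 0)"

definition weighted_L2_product ::
  "'a measure \<Rightarrow> 'a set \<Rightarrow> ('a \<Rightarrow> real) \<Rightarrow> ('a \<Rightarrow> real) \<Rightarrow> ('a \<Rightarrow> real) \<Rightarrow> real" where
  "weighted_L2_product M A w f g = (LINT x:A|M. w x * f x * g x)"

definition continuous_form ::
  "real \<Rightarrow> ('v::real_normed_vector \<Rightarrow> 'w::real_normed_vector \<Rightarrow> real) \<Rightarrow> bool" where
  "continuous_form K b \<longleftrightarrow> (\<forall>v w. \<bar>b v w\<bar> \<le> K * norm v * norm w)"

definition coercive_form :: "real \<Rightarrow> ('v::real_normed_vector \<Rightarrow> 'v \<Rightarrow> real) \<Rightarrow> bool" where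
  "coercive_form \<gamma> b \<longleftrightarrow> 0 < \<gamma> \<and> (\<forall>v. \<gamma> * (norm v)\<^sup>2 \<le> b v v)"

text \<open>
  In the two definitions below, \<open>c\<close> is defined on \<open>U \<times> Y\<close> and \<open>j\<close> is the inclusion of \<open>Y\<close> into \<open>U\<close>;
  \<open>mobs\<close> is the extension of \<open>m\<close> to observations in the first argument.
\<close>

definition steady_form ::
  "real \<Rightarrow> ('y \<Rightarrow> 'y \<Rightarrow> real) \<Rightarrow> ('u \<Rightarrow> 'y \<Rightarrow> real) \<Rightarrow> ('y \<Rightarrow> 'y \<Rightarrow> real) \<Rightarrow> ('y \<Rightarrow> 'u) \<Rightarrow>
   'y \<times> 'y \<Rightarrow> 'y \<times> 'y \<Rightarrow> real" where
  "steady_form \<alpha> a c m j = (\<lambda>(y, p) (z, q).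
     a y z - 1 / \<alpha> * c (j p) z + m y q + a q p)"

definition steady_rhs ::
  "('o \<Rightarrow> 'y \<Rightarrow> real) \<Rightarrow> ('y::real_normed_vector \<Rightarrow>\<^sub>L real) \<Rightarrow> 'o \<Rightarrow> 'y \<times> 'y \<Rightarrow> real" where
  "steady_rhs mobs G yd = (\<lambda>(z, q). mobs yd q + blinfun_apply G z)"

end

theory Submission
  imports Defs
begin

text \<open>
  Testing with \<open>(-p, y)\<close> cancels the two state terms and leaves \<open>m(y, y) + c(p, p) / \<alpha> \<ge> 0\<close>, while
  testing with \<open>(y, p)\<close> gives \<open>a(y, y) + a(p, p)\<close> plus indefinite coupling terms. Hence the rotated
  form with test functions \<open>(y, p) + K (-p, y)\<close> is coercive for large \<open>K\<close>. This change of test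
  functions is a bijection of \<open>Y \<times> Y\<close>, so the Lax-Milgram theorem for the rotated form solves
  the original problem.
\<close>

section \<open>Riesz representation and the Lax-Milgram theorem\<close>

text \<open>For the vector \<open>r\<close> sought, \<open>J x\<close> equals
  \<open>(norm (x - r))\<^sup>2 - (norm r)\<^sup>2\<close>, so \<open>r\<close> is found as the
  minimizer of \<open>J\<close>. Completeness provides the minimizer, and the vanishing first
  variation of \<open>J\<close> there is the claim.\<close>

lemma riesz_representation:
  fixes f :: "'a::{real_inner, complete_space} \<Rightarrow> real"
  assumes "bounded_linear f"
  shows "\<exists>r. \<forall>x. f x = r \<bullet> x"
proof -
  interpret f: bounded_linear f by fact
  define J where "J x = x \<bullet> x - 2 * f x" for x
  define I where "I = Inf (range J)"
  obtain C where C: "\<And>x. \<bar>f x\<bar> \<le> norm x * C"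
    using f.bounded by auto
  have "- C\<^sup>2 \<le> J x" for x
  proof -
    have "f x \<le> norm x * C"
      using C[of x] by linarith
    moreover have "0 \<le> (norm x - C)\<^sup>2"
      by simp
    ultimately show ?thesis
      by (simp add: J_def power2_norm_eq_inner[symmetric] power2_diff)
  qed
  then have "bdd_below (range J)"
    by (auto intro!: bdd_belowI)
  then have I_le: "I \<le> J x" for x
    unfolding I_def by (intro cInf_lower) auto
  have "\<exists>x. J x < I + 1 / Suc n" for n
    using cInf_lessD[of "range J" "I + 1 / Suc n"] by (auto simp: I_def)
  then obtain X where X: "\<And>n. J (X n) < I + 1 / Suc n"
    by metis
  \<comment> \<open>the parallelogram law makes minimizing sequences Cauchy\<close>
  have par: "(norm (x - y))\<^sup>2 \<le> 2 * (J x - I) + 2 * (J y - I)" for x y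
  proof -
    have "(norm (x - y))\<^sup>2 = 2 * J x + 2 * J y - 4 * J ((1 / 2) *\<^sub>R (x + y))"
      by (simp add: J_def power2_norm_eq_inner f.scaleR f.add inner_commute algebra_simps)
    then show ?thesis
      using I_le[of "(1 / 2) *\<^sub>R (x + y)"] by simp
  qed
  have "Cauchy X"
  proof (rule metric_CauchyI)
    fix e :: real
    assume "0 < e"
    \<comment> \<open>The bound \<open>par\<close> doubles the excess over \<open>I\<close> at both
      points, so an excess below \<open>e\<^sup>2 / 4\<close> at each keeps the squared distance
      below \<open>e\<^sup>2\<close>.\<close>
    then obtain N where N: "1 / Suc N < e\<^sup>2 / 4"
      using nat_approx_posE[of "e\<^sup>2 / 4"] by auto
    have small: "J (X n) - I < e\<^sup>2 / 4" if "N \<le> n" for n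
    proof -
      have "1 / Suc n \<le> 1 / Suc N"
        using that by (simp add: frac_le)
      then show ?thesis
        using X[of n] N by linarith
    qed
    have "dist (X k) (X n) < e" if "N \<le> k" "N \<le> n" for k n
    proof -
      have "(norm (X k - X n))\<^sup>2 \<le> 2 * (J (X k) - I) + 2 * (J (X n) - I)"
        by (rule par)
      also have "\<dots> < 2 * (e\<^sup>2 / 4) + 2 * (e\<^sup>2 / 4)"
        using that by (intro add_strict_mono mult_strict_left_mono small) auto
      finally have "(norm (X k - X n))\<^sup>2 < e\<^sup>2"
        by simp
      then show ?thesis
        using \<open>0 < e\<close> by (simp add: dist_norm power2_less_imp_less)
    qed
    then show "\<exists>N. \<forall>k\<ge>N. \<forall>n\<ge>N. dist (X k) (X n) < e"
      by blast
  qed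
  then obtain r where r: "X \<longlonglongrightarrow> r"
    using Cauchy_convergent convergent_def by blast
  have "(\<lambda>n. J (X n)) \<longlonglongrightarrow> J r"
    unfolding J_def by (intro tendsto_intros f.tendsto r)
  moreover have "(\<lambda>n. I + 1 / Suc n) \<longlonglongrightarrow> I"
    using tendsto_add[OF tendsto_const LIMSEQ_Suc[OF lim_1_over_n]] by (force simp del: of_nat_Suc)
  ultimately have "J r \<le> I"
    using X by (intro LIMSEQ_le) (auto intro: less_imp_le)
  then have min: "J r \<le> J x" for x
    using I_le[of x] by linarith
  have "f x = r \<bullet> x" for x
  proof (cases "x = 0")
    case False
    define b where "b = r \<bullet> x - f x"
    \<comment> \<open>This \<open>t\<close> minimizes \<open>J (r + t *\<^sub>R x)\<close>, a
      quadratic polynomial in \<open>t\<close>. The minimum lies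
      \<open>b\<^sup>2 / (x \<bullet> x)\<close> below \<open>J r\<close>, so minimality of
      \<open>r\<close> forces \<open>b = 0\<close>.\<close>
    define t where "t = - b / (x \<bullet> x)"
    have pos: "0 < x \<bullet> x"
      using False by simp
    have "J (r + t *\<^sub>R x) = J r + 2 * t * b + t\<^sup>2 * (x \<bullet> x)"
      by (simp add: J_def b_def f.scaleR f.add inner_commute algebra_simps power2_eq_square)
    also have "\<dots> = J r - b\<^sup>2 / (x \<bullet> x)"
      using pos by (simp add: t_def field_simps power2_eq_square)
    finally have "b\<^sup>2 / (x \<bullet> x) \<le> 0"
      using min[of "r + t *\<^sub>R x"] by linarith
    with pos have "b = 0"
      by (auto simp: divide_le_0_iff simp del: inner_gt_zero_iff)
    then show ?thesis
      by (simp add: b_def)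
  qed (simp add: f.zero)
  then show ?thesis
    by blast
qed

text \<open>Riesz representation turns the equation into \<open>A x = r\<close>. Its solutions are
  the fixed points of the damped iteration \<open>x - \<rho> *\<^sub>R (A x - r)\<close>, which
  coercivity makes a contraction for a suitable step size, so Banach's theorem gives existence and
  uniqueness together.\<close>

theorem lax_milgram:
  fixes B :: "'a::{real_inner, complete_space} \<Rightarrow> 'a \<Rightarrow> real"
  assumes "bounded_bilinear B" and coercive: "coercive_form \<gamma> B" and f: "bounded_linear f"
  shows "\<exists>!x. \<forall>w. B x w = f w"
proof -
  interpret B: bounded_bilinear B by fact
  have \<gamma>: "0 < \<gamma>" "\<And>x. \<gamma> * (norm x)\<^sup>2 \<le> B x x"
    using coercive by (auto simp: coercive_form_def)
  have "\<exists>r. \<forall>w. B x w = r \<bullet> w" for x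
    by (rule riesz_representation) (rule B.bounded_linear_right)
  then obtain A where A: "\<And>x w. B x w = A x \<bullet> w"
    by metis
  obtain r where r: "\<And>w. f w = r \<bullet> w"
    using riesz_representation[OF f] by blast
  have A_diff: "A (x - y) = A x - A y" for x y
    by (rule vector_eq_rdot[THEN iffD1])
      (metis A B.diff_left inner_diff_left)
  obtain C0 where C0: "\<And>x w. \<bar>B x w\<bar> \<le> norm x * norm w * C0"
    using B.bounded by auto
  \<comment> \<open>The maximum ensures \<open>\<gamma> / C \<le> 1\<close>, so that the contraction
    constant \<open>k\<close> is the root of a nonnegative number.\<close>
  define C where "C = max C0 \<gamma>"
  have C: "0 < C" "\<gamma> \<le> C"
    using \<gamma> by (auto simp: C_def)
  have A_bound: "norm (A x) \<le> C * norm x" for x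
  proof -
    \<comment> \<open>The form is tested with \<open>A x\<close> itself; one factor
      \<open>norm (A x)\<close> is cancelled afterwards.\<close>
    have "norm (A x) * norm (A x) \<le> norm x * norm (A x) * C0"
      using C0[of x "A x"] by (simp add: A dot_square_norm power2_eq_square)
    also have "\<dots> \<le> norm x * norm (A x) * C"
      by (intro mult_left_mono) (auto simp: C_def)
    finally have *: "norm (A x) * norm (A x) \<le> (C * norm x) * norm (A x)"
      by (simp add: mult_ac)
    show ?thesis
    proof (cases "A x = 0")
      case True
      then show ?thesis using C by simp
    next
      case False
      then show ?thesis using * by simp
    qed
  qed
  \<comment> \<open>the step size \<open>\<gamma> / C\<^sup>2\<close> minimizes the contraction constant below\<close>
  define \<rho> where "\<rho> = \<gamma> / C\<^sup>2"
  define k where "k = sqrt (1 - (\<gamma> / C)\<^sup>2)"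
  have ratio: "0 < \<gamma> / C" "\<gamma> / C \<le> 1"
    using \<gamma> C by auto
  have k: "0 \<le> k" "k < 1"
    using ratio by (auto simp: k_def power_le_one)
  have contraction: "norm (x - \<rho> *\<^sub>R A x) \<le> k * norm x" for x
  proof (rule power2_le_imp_le)
    have "(norm (x - \<rho> *\<^sub>R A x))\<^sup>2 = (norm x)\<^sup>2 - 2 * \<rho> * B x x + \<rho>\<^sup>2 * (norm (A x))\<^sup>2"
      by (simp add: A power2_norm_eq_inner inner_commute inner_diff_left inner_diff_right)
        (simp add: algebra_simps power2_eq_square)
    also have "\<dots> \<le> (norm x)\<^sup>2 - 2 * \<rho> * (\<gamma> * (norm x)\<^sup>2) + \<rho>\<^sup>2 * (C * norm x)\<^sup>2"
      using \<gamma> C A_bound[of x]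
      by (intro add_mono diff_mono mult_left_mono power_mono) (auto simp: \<rho>_def)
    also have "\<dots> = (1 - (\<gamma> / C)\<^sup>2) * (norm x)\<^sup>2"
      using C by (simp add: \<rho>_def field_simps power2_eq_square)
    also have "\<dots> = (k * norm x)\<^sup>2"
      using ratio by (simp add: k_def power_mult_distrib power_le_one)
    finally show "(norm (x - \<rho> *\<^sub>R A x))\<^sup>2 \<le> (k * norm x)\<^sup>2" .
  qed (use k in auto)
  have "\<exists>!x. x - \<rho> *\<^sub>R (A x - r) = x"
  proof (rule banach_fix_type[OF k], intro allI)
    fix x y
    show "dist (x - \<rho> *\<^sub>R (A x - r)) (y - \<rho> *\<^sub>R (A y - r)) \<le> k * dist x y"
      using contraction[of "x - y"] by (simp add: dist_norm A_diff algebra_simps)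
  qed
  moreover have "x - \<rho> *\<^sub>R (A x - r) = x \<longleftrightarrow> (\<forall>w. B x w = f w)" for x
    using \<gamma> C by (simp add: \<rho>_def A r vector_eq_rdot)
  ultimately show ?thesis
    by simp
qed

section \<open>Bounded bilinear forms and a weighted Young inequality\<close>

lemma bounded_bilinear_continuous_form:
  assumes "bilinear b" "continuous_form K b"
  shows "bounded_bilinear b"
proof
  show "\<exists>K. \<forall>x y. norm (b x y) \<le> norm x * norm y * K"
    using assms(2) by (auto simp: continuous_form_def mult_ac)
qed (use assms(1) in \<open>auto simp: bilinear_ladd bilinear_radd bilinear_lmul bilinear_rmul\<close>)

lemma bounded_bilinear_add:
  assumes "bounded_bilinear f" "bounded_bilinear g"
  shows "bounded_bilinear (\<lambda>x y. f x y + g x y)"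
proof -
  interpret f: bounded_bilinear f by fact
  interpret g: bounded_bilinear g by fact
  obtain K L where "\<And>x y. norm (f x y) \<le> norm x * norm y * K"
    "\<And>x y. norm (g x y) \<le> norm x * norm y * L"
    using f.bounded g.bounded by blast
  then have "norm (f x y + g x y) \<le> norm x * norm y * (K + L)" for x y
    by (simp add: distrib_left norm_triangle_mono)
  then show ?thesis
    by unfold_locales
      (auto simp: f.add_left f.add_right g.add_left g.add_right f.scaleR_left f.scaleR_right
        g.scaleR_left g.scaleR_right scaleR_add_right)
qed

text \<open>Completing the square: the expression is the value of \<open>b\<close> on the diagonal
  at \<open>(2 * K) *\<^sub>R x + y\<close>, divided by \<open>4 * K\<close>.\<close>

lemma semidefinite_cross_term:
  fixes b :: "'a::real_normed_vector \<Rightarrow> 'a \<Rightarrow> real"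
  assumes "bounded_bilinear b" and sym: "\<And>x y. b x y = b y x" and pos: "\<And>x. 0 \<le> b x x"
    and K: "0 < K"
  shows "0 \<le> K * b x x + b x y + b y y / (4 * K)"
proof -
  interpret b: bounded_bilinear b by fact
  have "b ((2 * K) *\<^sub>R x + y) ((2 * K) *\<^sub>R x + y) = 4 * K * (K * b x x + b x y + b y y / (4 * K))"
    using K sym[of y x]
    by (simp add: b.add_left b.add_right b.scaleR_left b.scaleR_right field_simps)
  then have "0 \<le> 4 * K * (K * b x x + b x y + b y y / (4 * K))"
    using pos by metis
  with K show ?thesis
    by (simp add: zero_le_mult_iff)
qed

section \<open>Unique solvability of the abstract optimality system\<close>

theorem semidefinite_optimality_system_unique_solution:
  fixes a c m :: "'y::{real_inner, complete_space} \<Rightarrow> 'y \<Rightarrow> real"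
  assumes a: "bounded_bilinear a" "coercive_form \<gamma> a"
    and c: "bounded_bilinear c" "\<And>y z. c y z = c z y" "\<And>y. 0 \<le> c y y"
    and m: "bounded_bilinear m" "\<And>y z. m y z = m z y" "\<And>y. 0 \<le> m y y"
    and f: "bounded_linear f"
  shows "\<exists>!x. \<forall>w. a (fst x) (fst w) - c (snd x) (fst w) + m (fst x) (snd w) + a (snd w) (snd x)
    = f w"
proof -
  interpret a: bounded_bilinear a by fact
  interpret c: bounded_bilinear c by fact
  interpret m: bounded_bilinear m by fact
  define B where
    "B x w = a (fst x) (fst w) - c (snd x) (fst w) + m (fst x) (snd w) + a (snd w) (snd x)" for x w
  have \<gamma>: "0 < \<gamma>" "\<And>y. \<gamma> * (norm y)\<^sup>2 \<le> a y y"
    using a(2) by (auto simp: coercive_form_def)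
  obtain Cc Cm where C: "0 < Cc" "0 < Cm" "\<And>y z. \<bar>c y z\<bar> \<le> norm y * norm z * Cc"
      "\<And>y z. \<bar>m y z\<bar> \<le> norm y * norm z * Cm"
    using c.pos_bounded m.pos_bounded by auto
  \<comment> \<open>The choice makes \<open>max Cc Cm / (4 * K) = \<gamma> / 2\<close>. By
    \<open>diag\<close>, each of the remainders \<open>c y y / (4 * K)\<close> and
    \<open>m p p / (4 * K)\<close> then consumes only half of the coercivity of
    \<open>a\<close>.\<close>
  define K where "K = max Cc Cm / (2 * \<gamma>)"
  have K: "0 < K"
    using C \<gamma> by (simp add: K_def less_max_iff_disj)
  have diag: "b y y / (4 * K) \<le> \<gamma> / 2 * (norm y)\<^sup>2"
    if "\<And>y z. \<bar>b y z\<bar> \<le> norm y * norm z * D" "D \<le> max Cc Cm" for b :: "'y \<Rightarrow> 'y \<Rightarrow> real" and y D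
  proof -
    have "b y y \<le> (norm y)\<^sup>2 * D"
      using that(1)[of y y] by (simp add: power2_eq_square)
    also have "\<dots> \<le> (norm y)\<^sup>2 * max Cc Cm"
      using that(2) by (intro mult_left_mono) auto
    also have "\<dots> = (\<gamma> / 2 * (norm y)\<^sup>2) * (4 * K)"
      using \<gamma> by (simp add: K_def)
    finally show ?thesis
      using K by (subst pos_divide_le_eq) auto
  qed
  define T :: "'y \<times> 'y \<Rightarrow> 'y \<times> 'y" where
    "T w = (fst w - K *\<^sub>R snd w, snd w + K *\<^sub>R fst w)" for w
  have T: "bounded_linear T"
    unfolding T_def by (intro bounded_linear_intros)
  have K2: "1 + K * K \<noteq> 0"
    by (smt (verit) zero_le_square)
  \<comment> \<open>As a block matrix, \<open>T\<close> has rows \<open>(1, -K)\<close> and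
    \<open>(K, 1)\<close>: a rotation combined with a scaling. Its inverse is its transpose divided
    by the determinant \<open>1 + K * K\<close>.\<close>
  have "w = T ((1 / (1 + K * K)) *\<^sub>R (fst w + K *\<^sub>R snd w, snd w - K *\<^sub>R fst w))" for w
  proof -
    have "(1 / (1 + K * K)) *\<^sub>R ((1 + K * K) *\<^sub>R v) = v" for v :: 'y
      using K2 by simp
    moreover have "T (fst w + K *\<^sub>R snd w, snd w - K *\<^sub>R fst w)
        = ((1 + K * K) *\<^sub>R fst w, (1 + K * K) *\<^sub>R snd w)"
      by (simp add: T_def algebra_simps)
    ultimately show ?thesis
      by (simp add: linear_scale[OF bounded_linear.linear[OF T]] del: scaleR_Pair scaleR_scaleR)
         (simp add: prod_eq_iff)
  qed
  then have "surj T"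
    by (rule surjI[OF sym])
  have bB: "bounded_bilinear (\<lambda>x w. B x (T w))"
  proof -
    \<comment> \<open>The minus sign of the coupling term is moved into the second argument of
      \<open>c\<close>, so that only sums of composed forms have to be treated.\<close>
    have "bounded_bilinear (\<lambda>x w. a (fst x) (fst w) + c (snd x) (- fst w) + m (fst x) (snd w)
        + a (snd w) (snd x))"
      by (intro bounded_bilinear_add a.comp c.comp m.comp bounded_bilinear.comp[OF a.flip]
          bounded_linear_fst bounded_linear_snd bounded_linear_minus)
    then have "bounded_bilinear B"
      by (simp add: B_def[abs_def] c.minus_right)
    then show ?thesis
      using bounded_bilinear.comp[OF _ bounded_linear_ident T] by blast
  qed
  have "coercive_form (\<gamma> / 2) (\<lambda>x w. B x (T w))"
    unfolding coercive_form_def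
  proof (intro conjI allI)
    fix x :: "'y \<times> 'y"
    obtain y p where x: "x = (y, p)"
      by fastforce
    \<comment> \<open>The mixed state terms \<open>- K * a y p\<close> and \<open>K * a y p\<close>
      cancel even for nonsymmetric \<open>a\<close>, because the adjoint term of \<open>B\<close>
      has the arguments of \<open>a\<close> exchanged.\<close>
    have "B x (T x) = a y y + a p p + (K * c p p + c p (- y)) + (K * m y y + m y p)"
      by (simp add: x B_def T_def a.add_left a.add_right a.diff_right a.scaleR_left a.scaleR_right
          c.diff_right c.scaleR_right c.minus_right m.add_right m.scaleR_right)
    moreover have "0 \<le> K * c p p + c p (- y) + c y y / (4 * K)"
      using semidefinite_cross_term[OF c K, of p "- y"] by (simp add: c.minus_left c.minus_right)
    moreover have "0 \<le> K * m y y + m y p + m p p / (4 * K)"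
      by (rule semidefinite_cross_term[OF m K])
    moreover have "c y y / (4 * K) \<le> \<gamma> / 2 * (norm y)\<^sup>2"
      by (rule diag[OF C(3)]) simp
    moreover have "m p p / (4 * K) \<le> \<gamma> / 2 * (norm p)\<^sup>2"
      by (rule diag[OF C(4)]) simp
    moreover have "(norm x)\<^sup>2 = (norm y)\<^sup>2 + (norm p)\<^sup>2"
      by (simp add: x norm_Pair)
    ultimately show "\<gamma> / 2 * (norm x)\<^sup>2 \<le> B x (T x)"
      using \<gamma>(2)[of y] \<gamma>(2)[of p] by (simp add: distrib_left)
  qed (use \<gamma> in simp)
  then have "\<exists>!x. \<forall>w. B x (T w) = f (T w)"
    using bB bounded_linear_compose[OF f T] by (intro lax_milgram)
  \<comment> \<open>Only the test functions are transformed; the unknown \<open>x\<close> is the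
    same in both problems, so surjectivity of \<open>T\<close> transfers existence and uniqueness
    alike.\<close>
  moreover have "(\<forall>w. B x (T w) = f (T w)) \<longleftrightarrow> (\<forall>w. B x w = f w)" for x
    using \<open>surj T\<close> by (metis surjD)
  ultimately show ?thesis
    by (simp add: B_def)
qed

section \<open>Application to the parametrized control problem\<close>

theorem theorem2:
  fixes P :: "(real ^ 'd) set"
    and \<Omega> \<Omega>obs \<Omega>u :: "(real ^ 'n) set"
    and \<sigma> :: "(real ^ 'n) measure"
    and \<alpha> :: real
    and repY :: "'y::{real_inner, complete_space} \<Rightarrow> real ^ 'n \<Rightarrow> real"
    and repU :: "'u::{real_inner, complete_space} \<Rightarrow> real ^ 'n \<Rightarrow> real"
    and jU :: "'y \<Rightarrow> 'u"
    and jobs :: "'y \<Rightarrow> 'o::{real_inner, complete_space}"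
    and a m :: "real ^ 'd \<Rightarrow> 'y \<Rightarrow> 'y \<Rightarrow> real"
    and c :: "real ^ 'd \<Rightarrow> 'u \<Rightarrow> 'y \<Rightarrow> real"
    and mobs :: "real ^ 'd \<Rightarrow> 'o \<Rightarrow> 'y \<Rightarrow> real"
    and G :: "real ^ 'd \<Rightarrow> ('y \<Rightarrow>\<^sub>L real)"
    and ca \<gamma>a cc cm cobs cu :: "real ^ 'd \<Rightarrow> real"
    and QC :: nat
    and cC :: "nat \<Rightarrow> real ^ 'd \<Rightarrow> real"
    and \<Omega>C :: "nat \<Rightarrow> (real ^ 'n) set"
    and wobs :: "real ^ 'd \<Rightarrow> real ^ 'n \<Rightarrow> real"
  assumes dim: "CARD('n) \<in> {1, 2, 3}"
    and domain: "regular_domain \<Omega>"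
    and obs_domain: "\<Omega>obs \<subseteq> \<Omega>" "\<Omega>obs \<in> sets borel"
    and control_domain: "\<Omega>u \<subseteq> closure \<Omega>" "\<Omega>u \<in> sets borel"
    and control_measure: "control_measure \<Omega> \<sigma>"
    and alpha: "0 < \<alpha>" "\<alpha> \<le> 1"
    \<comment> \<open>the spaces and the inclusions of \<open>Y\<close> into \<open>U\<close> and into the observation space\<close>
    and Y_separable: "separable_space (euclidean :: 'y topology)"
    and Y_L2: "contained_in_L2 lborel \<Omega> repY"
    and U_L2: "contained_in_L2 \<sigma> \<Omega>u repU"
    and Y_U: "linear jU" "\<And>y. AE x\<in>\<Omega>u in \<sigma>. repU (jU y) x = repY y x"
    and Y_U_bound: "\<And>\<mu>. \<mu> \<in> P \<Longrightarrow> 0 < cu \<mu> \<and> (\<forall>y. norm (jU y) \<le> cu \<mu> * norm y)"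
    and Y_obs: "linear jobs"
    and Y_obs_bound: "\<And>\<mu>. \<mu> \<in> P \<Longrightarrow> 0 < cobs \<mu> \<and> (\<forall>y. norm (jobs y) \<le> cobs \<mu> * norm y)"
    \<comment> \<open>the state form\<close>
    and a: "\<And>\<mu>. \<mu> \<in> P \<Longrightarrow> bilinear (a \<mu>)"
           "\<And>\<mu>. \<mu> \<in> P \<Longrightarrow> continuous_form (ca \<mu>) (a \<mu>)"
           "\<And>\<mu>. \<mu> \<in> P \<Longrightarrow> coercive_form (\<gamma>a \<mu>) (a \<mu>)"
    \<comment> \<open>the control form\<close>
    and c: "\<And>\<mu>. \<mu> \<in> P \<Longrightarrow> bilinear (c \<mu>)"
           "\<And>\<mu>. \<mu> \<in> P \<Longrightarrow> continuous_form (cc \<mu>) (c \<mu>)"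
    and control_subdomains: "\<And>i. i \<in> {1..QC} \<Longrightarrow> \<Omega>C i \<in> sets borel" "(\<Union>i\<in>{1..QC}. \<Omega>C i) = \<Omega>u"
    and control_coeffs: "\<And>i \<mu>. i \<in> {1..QC} \<Longrightarrow> \<mu> \<in> P \<Longrightarrow> 0 < cC i \<mu>"
    and c_L2: "\<And>\<mu> u z. \<mu> \<in> P \<Longrightarrow>
           c \<mu> u z = weighted_L2_product \<sigma> \<Omega>u
             (\<lambda>x. \<Sum>i=1..QC. cC i \<mu> * indicator (\<Omega>C i) x) (repU u) (repU (jU z))"
    \<comment> \<open>the observation form\<close>
    and m: "\<And>\<mu>. \<mu> \<in> P \<Longrightarrow> bilinear (m \<mu>)"
           "\<And>\<mu> y z. \<mu> \<in> P \<Longrightarrow> m \<mu> y z = m \<mu> z y"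
           "\<And>\<mu> y. \<mu> \<in> P \<Longrightarrow> 0 \<le> m \<mu> y y"
           "\<And>\<mu>. \<mu> \<in> P \<Longrightarrow> continuous_form (cm \<mu>) (m \<mu>)"
    and obs_weight: "\<And>\<mu>. \<mu> \<in> P \<Longrightarrow> set_borel_measurable lborel \<Omega>obs (wobs \<mu>)"
           "\<And>\<mu> x. \<mu> \<in> P \<Longrightarrow> x \<in> \<Omega>obs \<Longrightarrow> 0 < wobs \<mu> x"
    and m_L2: "\<And>\<mu> y z. \<mu> \<in> P \<Longrightarrow>
           set_integrable lborel \<Omega>obs (\<lambda>x. wobs \<mu> x * repY y x * repY z x)"
           "\<And>\<mu> y z. \<mu> \<in> P \<Longrightarrow>
           m \<mu> y z = weighted_L2_product lborel \<Omega>obs (wobs \<mu>) (repY y) (repY z)"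
    and mobs: "\<And>\<mu>. \<mu> \<in> P \<Longrightarrow> bounded_bilinear (mobs \<mu>)"
           "\<And>\<mu> y z. \<mu> \<in> P \<Longrightarrow> mobs \<mu> (jobs y) z = m \<mu> y z"
    and coincide: "\<And>\<mu> y z. \<mu> \<in> P \<Longrightarrow> \<Omega>u = \<Omega>obs \<Longrightarrow> c \<mu> (jU y) z = m \<mu> y z"
  shows "\<forall>\<mu>\<in>P. \<forall>yd. \<exists>!yp. \<forall>zq.
           steady_form \<alpha> (a \<mu>) (c \<mu>) (m \<mu>) jU yp zq = steady_rhs (mobs \<mu>) (G \<mu>) yd zq"
proof (intro ballI allI)
  fix \<mu> yd
  assume \<mu>: "\<mu> \<in> P"
  \<comment> \<open>The factor \<open>1 / \<alpha>\<close> is absorbed into the second argument and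
    the inclusion \<open>jU\<close> into the first. This gives a form on \<open>Y\<close> alone
    whose boundedness follows by composing \<open>c \<mu>\<close> with bounded linear maps.\<close>
  define C where "C p z = c \<mu> (jU p) ((1 / \<alpha>) *\<^sub>R z)" for p z
  define w where "w x = (\<Sum>i=1..QC. cC i \<mu> * indicator (\<Omega>C i) x)" for x
  have "bounded_linear jU"
    using Y_U(1) Y_U_bound[OF \<mu>]
    by (intro bounded_linear_intro[where K = "cu \<mu>"])
      (auto simp: linear_add linear_scale mult.commute)
  then have C: "bounded_bilinear C"
    unfolding C_def
    by (intro bounded_bilinear.comp[OF bounded_bilinear_continuous_form[OF c[OF \<mu>]]]
        bounded_linear_scaleR_right)
  have C_eq: "C p z = 1 / \<alpha> * c \<mu> (jU p) z" for p z
    using bilinear_rmul[OF c(1)[OF \<mu>]] by (simp add: C_def)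
  \<comment> \<open>Both arguments now enter through \<open>repU\<close> after \<open>jU\<close>.
    Hence the integrand is symmetric in \<open>p\<close> and \<open>z\<close>, and on the diagonal
    it is the weight times a square.\<close>
  have C_L2: "C p z = 1 / \<alpha> * (LINT x:\<Omega>u|\<sigma>. w x * repU (jU p) x * repU (jU z) x)" for p z
    by (simp add: C_eq c_L2[OF \<mu>] weighted_L2_product_def w_def)
  have "0 \<le> w x" for x
    unfolding w_def using control_coeffs[OF _ \<mu>]
    by (intro sum_nonneg mult_nonneg_nonneg) (auto intro: less_imp_le)
  \<comment> \<open>A nonnegative integrand suffices, as the integral takes the value 0 where
    integrability fails.\<close>
  then have "0 \<le> C p p" for p
    using alpha unfolding C_L2 set_lebesgue_integral_def
    by (auto intro!: mult_nonneg_nonneg integral_nonneg simp: mult.assoc)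
  moreover have "C p z = C z p" for p z
    by (simp add: C_L2 mult_ac)
  moreover have "bounded_linear (steady_rhs (mobs \<mu>) (G \<mu>) yd)"
    unfolding steady_rhs_def case_prod_beta
    by (intro bounded_linear_add bounded_linear_compose[OF bounded_linear_fst]
        bounded_linear_compose[OF bounded_bilinear.bounded_linear_right[OF mobs(1)[OF \<mu>]]]
        bounded_linear_compose[OF blinfun.bounded_linear_right]
        bounded_linear_fst bounded_linear_snd)
  ultimately have "\<exists>!x. \<forall>w. a \<mu> (fst x) (fst w) - C (snd x) (fst w) + m \<mu> (fst x) (snd w)
      + a \<mu> (snd w) (snd x) = steady_rhs (mobs \<mu>) (G \<mu>) yd w"
    using C m(2,3)[OF \<mu>] a(3)[OF \<mu>]
      bounded_bilinear_continuous_form[OF m(1,4)[OF \<mu>]]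
      bounded_bilinear_continuous_form[OF a(1,2)[OF \<mu>]]
    by (intro semidefinite_optimality_system_unique_solution)
  then show "\<exists>!yp. \<forall>zq.
      steady_form \<alpha> (a \<mu>) (c \<mu>) (m \<mu>) jU yp zq = steady_rhs (mobs \<mu>) (G \<mu>) yd zq"
    by (simp only: steady_form_def C_eq case_prod_beta)
qed

end
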